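(* For $n\ge 1$ let $B_n(x,y)=\sum_{\sigma\in\mathcal{B}_n}x^{\mathrm{des}_1\sigma}y^{\mathrm{des}_0\sigma}$ and let $\alpha=(1-x)(1-y)$. Then, as formal power series in $t$, $$\sum_{n\geq1}B_{2n}(x,y)\frac{t^{2n}}{(2n)!}=\frac{(x+y)\sum_{n\geq 0}\frac{\alpha^n (2t)^{2n}}{(2n)!}+\sum_{n\geq 0}\frac{\alpha^{n+1} t^{2n}}{(2n)!}-(1+xy)}{(1+xy)-(x+y)\sum_{n\geq 0}\frac{\alpha^n (2t)^{2n}}{(2n)!}},$$ and $$\sum_{n\geq 1}B_{2n-1}(x,y)\frac{t^{2n-1}}{(2n-1)!}=\frac{(y^2-1)(x-1)\,\sum_{n\geq 0}\frac{\alpha^{n} t^{2n+1}}{(2n+1)!}}{(1+xy)-(x+y)\sum_{n\geq 0}\frac{\alpha^n (2t)^{2n}}{(2n)!}}.$$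
   Context: $\mathcal{B}_n$ is the set of signed permutations, i.e. bijections $\sigma$ of $\{\pm1,\dots,\pm n\}$ with $\sigma(-i)=-\sigma(i)$; each $\sigma$ is identified with the word $\sigma(0)\sigma(1)\cdots\sigma(n)$ where $\sigma(0)=0$. A position $i\in\{0,1,\dots,n-1\}$ is a descent of $\sigma$ if $\sigma(i)>\sigma(i+1)$ and an ascent if $\sigma(i)<\sigma(i+1)$. $\mathrm{des}_1\sigma$ (resp. $\mathrm{des}_0\sigma$) is the number of descents at odd (resp. even, including $0$) positions. *)

theory Defs
  imports
    "HOL-Computational_Algebra.Computational_Algebra"
    "HOL-Combinatorics.Permutations"
begin

text \<open>
  A function that \<open>permutes\<close> \<open>{\<plusminus>1, \<dots>, \<plusminus>n}\<close> is the identity outside that set, so every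
  signed permutation has a unique representative here, and \<open>\<sigma> 0 = 0\<close> holds automatically.
\<close>

definition signed_perms :: "nat \<Rightarrow> (int \<Rightarrow> int) set" where
  "signed_perms n =
     {\<sigma>. \<sigma> permutes ({- int n..int n} - {0}) \<and>
         (\<forall>i \<in> {- int n..int n} - {0}. \<sigma> (- i) = - \<sigma> i)}"

definition descents :: "nat \<Rightarrow> (int \<Rightarrow> int) \<Rightarrow> nat set" where
  "descents n \<sigma> = {i \<in> {0..<n}. \<sigma> (int i) > \<sigma> (int (i + 1))}"

definition des1 :: "nat \<Rightarrow> (int \<Rightarrow> int) \<Rightarrow> nat" where
  "des1 n \<sigma> = card {i \<in> descents n \<sigma>. odd i}"

definition des0 :: "nat \<Rightarrow> (int \<Rightarrow> int) \<Rightarrow> nat" where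
  "des0 n \<sigma> = card {i \<in> descents n \<sigma>. even i}"

definition B :: "nat \<Rightarrow> 'a \<Rightarrow> 'a \<Rightarrow> 'a::comm_ring_1" where
  "B n x y = (\<Sum>\<sigma> \<in> signed_perms n. x ^ des1 n \<sigma> * y ^ des0 n \<sigma>)"

text \<open>
  The constant term \<open>(1 + x y) - (x + y) = (1 - x) (1 - y)\<close> of the denominator of the generating
  functions is not a unit in \<open>\<rat>[x, y]\<close>, so the quotients live in \<open>\<rat>(x, y)[[t]]\<close>.  In
  \<open>rat poly poly\<close> the inner variable is \<open>x\<close> and the outer one is \<open>y\<close>.
\<close>

type_synonym ratfun = "rat poly poly fract"

definition indet_x :: ratfun where
  "indet_x = to_fract [:[:0, 1:]:]"

definition indet_y :: ratfun where
  "indet_y = to_fract [:0, 1:]"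

text \<open>The power series \<open>\<Sum>n\<ge>0. a\<^sub>n t\<^bsup>2n\<^esup>\<close> and \<open>\<Sum>n\<ge>0. a\<^sub>n t\<^bsup>2n+1\<^esup>\<close>.\<close>

definition even_fps :: "(nat \<Rightarrow> 'a::zero) \<Rightarrow> 'a fps" where
  "even_fps a = Abs_fps (\<lambda>m. if even m then a (m div 2) else 0)"

definition odd_fps :: "(nat \<Rightarrow> 'a::zero) \<Rightarrow> 'a fps" where
  "odd_fps a = Abs_fps (\<lambda>m. if odd m then a (m div 2) else 0)"

lemma denominator_const_nonzero: "(1 + indet_x * indet_y) - (indet_x + indet_y) \<noteq> 0"
proof -
  have "(1 + indet_x * indet_y) - (indet_x + indet_y) = (1 - indet_x) * (1 - indet_y)"
    by (simp add: algebra_simps)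
  moreover have "indet_x \<noteq> 1" "indet_y \<noteq> 1"
    by (simp_all add: indet_x_def indet_y_def to_fract_def One_fract_def eq_fract one_pCons)
  ultimately show ?thesis by simp
qed

end

theory Submission
  imports Defs
begin

text \<open>
  A position of weight \<open>w\<close> (\<open>x\<close> if odd, \<open>y\<close> if even) contributes \<open>w + (1 - w) [ascent]\<close>. Expanding
  the positions from right to left, choosing \<open>(1 - w) [ascent]\<close> until \<open>w\<close> is chosen for the first
  time, splits off an increasing run of \<open>k\<close> last letters that is unrelated to the word in front of
  it. There are \<open>(n choose k) 2\<^sup>k\<close> such runs, and the front contributes \<open>B\<^bsub>n-k\<^esub>\<close>; if \<open>w\<close> is never
  chosen, the whole word is \<open>0 < 1 < \<dots> < n\<close>. For the exponential generating functions \<open>E\<close> and \<open>O\<close>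
  of even and odd index, the resulting recurrence is a linear system
    \<open>(1 - y C) E = (1 - y) (x S O + c)\<close> and \<open>(1 - x C) O = (1 - x) (y S E + (1 - y) s)\<close>,
  where \<open>C, S\<close> and \<open>c, s\<close> are \<open>cosh, sinh / \<surd>\<alpha>\<close> at \<open>2 \<surd>\<alpha> t\<close> and \<open>\<surd>\<alpha> t\<close>. It is solved by
  elimination, using \<open>C\<^sup>2 - \<alpha> S\<^sup>2 = 1\<close> and the addition theorems for \<open>2 \<surd>\<alpha> t - \<surd>\<alpha> t\<close>.
\<close>

section \<open>Signed words and their last increasing run\<close>

definition pos_weight :: "'a \<Rightarrow> 'a \<Rightarrow> nat \<Rightarrow> 'a" where
  "pos_weight x y i = (if odd i then x else y)"

text \<open>
  Words are stored in reverse: the list \<open>a # l\<close> is the word \<open>l\<close> followed by the last letter \<open>a\<close>,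
  which sits at position \<open>length l + 1\<close>. The value \<open>0\<close> for the empty word is \<open>\<sigma>(0)\<close>.
\<close>

fun last_letter :: "int list \<Rightarrow> int" where
  "last_letter [] = 0"
| "last_letter (a # l) = a"

fun word_weight :: "'a::comm_ring_1 \<Rightarrow> 'a \<Rightarrow> int list \<Rightarrow> 'a" where
  "word_weight x y [] = 1"
| "word_weight x y (a # l) =
     (if last_letter l > a then pos_weight x y (length l) else 1) * word_weight x y l"

text \<open>\<open>A\<close> holds the absolute values and is arbitrary, because the word in front
  of a run uses only the values that the run leaves over.\<close>

definition signed_words :: "int set \<Rightarrow> int list set" where
  "signed_words A = {l. distinct (map abs l) \<and> abs ` set l = A}"

definition word_sum :: "'a::comm_ring_1 \<Rightarrow> 'a \<Rightarrow> int set \<Rightarrow> 'a" where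
  "word_sum x y A = (\<Sum>l \<in> signed_words A. word_weight x y l)"

text \<open>An increasing run is determined by its letters, so it is encoded as a set; injectivity
  of \<open>abs\<close> forbids both signs of one value.\<close>

definition signed_subsets :: "int set \<Rightarrow> nat \<Rightarrow> int set set" where
  "signed_subsets A k = {V. finite V \<and> inj_on abs V \<and> abs ` V \<subseteq> A \<and> card V = k}"

text \<open>
  Sum over the words whose last \<open>k\<close> letters increase, with the descents inside this run ignored:
  \<open>V\<close> is the set of its letters and \<open>l\<close> the word in front of it.
\<close>

definition run_sum :: "'a::comm_ring_1 \<Rightarrow> 'a \<Rightarrow> int set \<Rightarrow> nat \<Rightarrow> 'a" where
  "run_sum x y A k = (\<Sum>(V, l) \<in> (SIGMA V : signed_subsets A k. signed_words (A - abs ` V)).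
     (if last_letter l > Min V then pos_weight x y (length l) else 1) * word_weight x y l)"

section \<open>Finiteness, removal of a letter, and enumeration\<close>

lemma length_signed_words:
  assumes "l \<in> signed_words A"
  shows "length l = card A"
  using assms distinct_card[of "map abs l"] by (simp add: signed_words_def)

lemma finite_signed_words:
  assumes "finite A"
  shows "finite (signed_words A)"
proof (rule finite_subset)
  show "signed_words A \<subseteq> {l. set l \<subseteq> A \<union> uminus ` A \<and> length l = card A}"
  proof
    fix l assume l: "l \<in> signed_words A"
    have "a \<in> A \<union> uminus ` A" if "a \<in> set l" for a
    proof -
      have "\<bar>a\<bar> \<in> A" using l that by (auto simp: signed_words_def)
      moreover have "a = \<bar>a\<bar> \<or> a = - \<bar>a\<bar>" by auto
      ultimately show ?thesis by (metis UnCI image_eqI)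
    qed
    with l show "l \<in> {l. set l \<subseteq> A \<union> uminus ` A \<and> length l = card A}"
      using length_signed_words by auto
  qed
  show "finite {l. set l \<subseteq> A \<union> uminus ` A \<and> length l = card A}"
    using assms by (intro finite_lists_length_eq) auto
qed

lemma finite_signed_subsets:
  assumes "finite A"
  shows "finite (signed_subsets A k)"
proof (rule finite_subset)
  show "signed_subsets A k \<subseteq> Pow (A \<union> uminus ` A)"
  proof
    fix V assume V: "V \<in> signed_subsets A k"
    have "a \<in> A \<union> uminus ` A" if "a \<in> V" for a
    proof -
      have "\<bar>a\<bar> \<in> A" using V that by (auto simp: signed_subsets_def)
      moreover have "a = \<bar>a\<bar> \<or> a = - \<bar>a\<bar>" by auto
      ultimately show ?thesis by (metis UnCI image_eqI)
    qed
    then show "V \<in> Pow (A \<union> uminus ` A)" by blast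
  qed
qed (use assms in auto)

lemma card_Diff_signed_subset:
  assumes "finite A" "V \<in> signed_subsets A k"
  shows "card (A - abs ` V) = card A - k"
  using assms by (auto simp: signed_subsets_def card_Diff_subset card_image)

lemma signed_subsets_0: "signed_subsets A 0 = {{}}"
  by (auto simp: signed_subsets_def)

lemma Cons_in_signed_words_iff:
  "a # l \<in> signed_words A \<longleftrightarrow> \<bar>a\<bar> \<in> A \<and> l \<in> signed_words (A - {\<bar>a\<bar>})"
proof -
  have "insert \<bar>a\<bar> C = A \<and> \<bar>a\<bar> \<notin> C \<longleftrightarrow> \<bar>a\<bar> \<in> A \<and> C = A - {\<bar>a\<bar>}" for C
    by blast
  from this[of "abs ` set l"] show ?thesis by (auto simp: signed_words_def)
qed

lemma signed_words_empty: "signed_words {} = {[]}"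
  by (auto simp: signed_words_def)

lemma Nil_in_signed_words_iff: "[] \<in> signed_words A \<longleftrightarrow> A = {}"
  by (auto simp: signed_words_def)

lemma insert_in_signed_subsets_iff:
  assumes "a \<notin> V"
  shows "insert a V \<in> signed_subsets A (Suc k) \<longleftrightarrow>
    \<bar>a\<bar> \<in> A \<and> V \<in> signed_subsets (A - {\<bar>a\<bar>}) k"
proof -
  have "insert \<bar>a\<bar> C \<subseteq> A \<and> \<bar>a\<bar> \<notin> C \<longleftrightarrow> \<bar>a\<bar> \<in> A \<and> C \<subseteq> A - {\<bar>a\<bar>}" for C
    by blast
  from this[of "abs ` V"] show ?thesis using assms by (auto simp: signed_subsets_def)
qed

lemma signed_subsets_insert:
  assumes "a > 0" "a \<notin> A"
  shows "signed_subsets (insert a A) (Suc k) = signed_subsets A (Suc k) \<union>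
    (insert a ` signed_subsets A k \<union> insert (- a) ` signed_subsets A k)"
    (is "?L = ?R")
proof
  show "?R \<subseteq> ?L"
  proof
    fix V assume "V \<in> ?R"
    moreover have "insert b U \<in> ?L" if "U \<in> signed_subsets A k" "b = a \<or> b = - a" for b U
    proof -
      have "b \<notin> U" "\<bar>b\<bar> = a" using assms that by (auto simp: signed_subsets_def)
      then show ?thesis using that assms by (simp add: insert_in_signed_subsets_iff)
    qed
    ultimately show "V \<in> ?L" by (auto simp: signed_subsets_def)
  qed
  show "?L \<subseteq> ?R"
  proof
    fix V assume V: "V \<in> ?L"
    show "V \<in> ?R"
    proof (cases "a \<in> abs ` V")
      case False
      with V show ?thesis by (auto simp: signed_subsets_def)
    next
      case True
      then obtain b where b: "b \<in> V" "\<bar>b\<bar> = a" by auto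
      have V': "insert b (V - {b}) = V" using b by auto
      have "V - {b} \<in> signed_subsets A k"
        using insert_in_signed_subsets_iff[of b "V - {b}" "insert a A" k] V b assms
        by (simp add: insert_absorb)
      moreover have "b = a \<or> b = - a" using b by auto
      ultimately show ?thesis using V' by (metis UnCI image_eqI)
    qed
  qed
qed

text \<open>Induction on \<open>A\<close>: a new value is absent or occurs with one of two signs,
  which is Pascal's rule with a factor 2 on the second term. Positivity keeps \<open>a\<close> and
  \<open>- a\<close> apart.\<close>

lemma card_signed_subsets:
  assumes "finite A" "A \<subseteq> {0<..}"
  shows "card (signed_subsets A k) = (card A choose k) * 2 ^ k"
  using assms
proof (induction A arbitrary: k rule: finite_induct)
  case empty
  show ?case
  proof (cases k)
    case 0
    then show ?thesis by (simp add: signed_subsets_0)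
  next
    case (Suc j)
    then have "signed_subsets {} k = {}" by (auto simp: signed_subsets_def)
    then show ?thesis using Suc by simp
  qed
next
  case (insert a A)
  show ?case
  proof (cases k)
    case 0
    then show ?thesis by (simp add: signed_subsets_0)
  next
    case (Suc j)
    have a: "a > 0" using insert by auto
    have notin: "a \<notin> V" "- a \<notin> V" if "V \<in> signed_subsets A i" for V i
      using that a insert.hyps by (auto simp: signed_subsets_def)
    have inj: "inj_on (insert b) (signed_subsets A j)" if "b = a \<or> b = - a" for b
      using that notin by (intro inj_onI) (metis insert_ident)
    have fin: "finite (signed_subsets A i)" for i
      using insert.hyps(1) by (rule finite_signed_subsets)
    have "card (insert a ` signed_subsets A j \<union> insert (- a) ` signed_subsets A j) =
        2 * card (signed_subsets A j)"
    proof (subst card_Un_disjoint)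
      show "insert a ` signed_subsets A j \<inter> insert (- a) ` signed_subsets A j = {}"
      proof -
        have "insert a V \<noteq> insert (- a) V'" if "V' \<in> signed_subsets A j" for V V'
          using notin(1)[OF that] a by (metis insert_iff less_irrefl neg_0_less_iff_less less_trans)
        then show ?thesis by blast
      qed
    qed (use fin inj in \<open>auto simp: card_image\<close>)
    moreover have "signed_subsets A (Suc j) \<inter>
        (insert a ` signed_subsets A j \<union> insert (- a) ` signed_subsets A j) = {}"
      using notin by blast
    ultimately have "card (signed_subsets (insert a A) (Suc j)) =
        card (signed_subsets A (Suc j)) + 2 * card (signed_subsets A j)"
      using fin a insert.hyps by (simp add: signed_subsets_insert card_Un_disjoint)
    then show ?thesis
      using insert.IH insert.prems insert.hyps Suc by (simp add: algebra_simps)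
  qed
qed

section \<open>Lengthening the last run\<close>

text \<open>A run of one letter has no inner descents to ignore, so this is the starting point of
  the expansion.\<close>

lemma run_sum_1:
  assumes "finite A" "A \<noteq> {}"
  shows "run_sum x y A 1 = word_sum x y A"
  unfolding run_sum_def word_sum_def
proof (rule sum.reindex_bij_witness
    [where i = "\<lambda>l. ({hd l}, tl l)" and j = "\<lambda>(V, l). Min V # l"])
  fix p assume "p \<in> (SIGMA V : signed_subsets A 1. signed_words (A - abs ` V))"
  then obtain a l where p: "p = ({a}, l)" "\<bar>a\<bar> \<in> A" "l \<in> signed_words (A - {\<bar>a\<bar>})"
    by (auto simp: signed_subsets_def card_1_singleton_iff)
  show "(\<lambda>l. ({hd l}, tl l)) (case p of (V, l) \<Rightarrow> Min V # l) = p"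
    and "(case p of (V, l) \<Rightarrow> Min V # l) \<in> signed_words A"
    and "word_weight x y (case p of (V, l) \<Rightarrow> Min V # l) =
      (case p of (V, l) \<Rightarrow>
        (if last_letter l > Min V then pos_weight x y (length l) else 1) * word_weight x y l)"
    using p by (simp_all add: Cons_in_signed_words_iff)
next
  fix l assume l: "l \<in> signed_words A"
  with assms obtain a m where m: "l = a # m"
    by (cases l) (auto simp: Nil_in_signed_words_iff)
  show "(case ({hd l}, tl l) of (V, l) \<Rightarrow> Min V # l) = l"
    and "({hd l}, tl l) \<in> (SIGMA V : signed_subsets A 1. signed_words (A - abs ` V))"
    using l m by (auto simp: Cons_in_signed_words_iff signed_subsets_def)
qed

text \<open>Excludes ties, so that a junction that is not a descent is an ascent. For an empty front
  this uses that the letters are nonzero.\<close>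

lemma last_letter_neq_Min:
  assumes "A \<subseteq> {0<..}" "V \<in> signed_subsets A k" "k > 0" "l \<in> signed_words (A - abs ` V)"
  shows "last_letter l \<noteq> Min V"
proof -
  have "Min V \<in> V" using assms by (intro Min_in) (auto simp: signed_subsets_def)
  then show ?thesis using assms by (cases l) (auto simp: signed_words_def signed_subsets_def)
qed

text \<open>At an ascending junction the last letter of the front can be moved into the run;
  removing the minimum of the longer run is the inverse.\<close>

lemma sum_ascending_runs:
  fixes x y :: "'a::comm_ring_1"
  assumes "finite A" "A \<subseteq> {0<..}" "0 < k" "k < card A"
  shows "(\<Sum>(V, l) \<in> (SIGMA V : signed_subsets A k. signed_words (A - abs ` V)).
      if last_letter l < Min V then word_weight x y l else 0) = run_sum x y A (Suc k)"
proof -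
  let ?P = "\<lambda>k. SIGMA V : signed_subsets A k. signed_words (A - abs ` V)"
  have fin: "finite (?P k)"
    using assms by (auto intro!: finite_signed_subsets finite_signed_words)
  have "(\<Sum>(V, l) \<in> ?P k. if last_letter l < Min V then word_weight x y l else 0) =
      (\<Sum>(V, l) \<in> {p \<in> ?P k. last_letter (snd p) < Min (fst p)}. word_weight x y l)"
    using fin by (simp add: case_prod_unfold sum.inter_filter)
  also have "\<dots> = run_sum x y A (Suc k)"
    unfolding run_sum_def
  proof (rule sum.reindex_bij_witness
      [where j = "\<lambda>(V, l). (insert (hd l) V, tl l)" and i = "\<lambda>(V, l). (V - {Min V}, Min V # l)"])
    fix p assume p: "p \<in> {p \<in> ?P k. last_letter (snd p) < Min (fst p)}"
    obtain V l where Vl: "p = (V, l)" by fastforce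
    have V: "V \<in> signed_subsets A k" "finite V" "V \<noteq> {}"
      and l: "l \<in> signed_words (A - abs ` V)" and less: "last_letter l < Min V"
      using p Vl assms by (auto simp: signed_subsets_def)
    \<comment> \<open>Since \<open>k < card A\<close>, the run does not exhaust the values and there
      is a letter to move.\<close>
    have "l \<noteq> []"
      using length_signed_words[OF l] card_Diff_signed_subset[OF assms(1) V(1)] assms by auto
    then obtain a m where m: "l = a # m" by (cases l) auto
    have am: "\<bar>a\<bar> \<in> A - abs ` V" "m \<in> signed_words (A - abs ` V - {\<bar>a\<bar>})"
      using l m by (auto simp: Cons_in_signed_words_iff)
    have notin: "a \<notin> V" using am by auto
    \<comment> \<open>The moved letter becomes the minimum, so its junction with \<open>m\<close> is
      exactly the one that \<open>run_sum\<close> weights.\<close>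
    have min: "Min (insert a V) = a" using V less m by (metis Min_insert last_letter.simps(2) min.absorb3)
    have ins: "insert a V \<in> signed_subsets A (Suc k)"
      using am V notin by (auto simp: insert_in_signed_subsets_iff signed_subsets_def)
    have diff: "A - abs ` insert a V = A - abs ` V - {\<bar>a\<bar>}" by auto
    show "(case case p of (V, l) \<Rightarrow> (insert (hd l) V, tl l) of
        (V, l) \<Rightarrow> (V - {Min V}, Min V # l)) = p"
      using Vl m min notin by simp
    show "(case p of (V, l) \<Rightarrow> (insert (hd l) V, tl l)) \<in> ?P (Suc k)"
      using Vl m am ins diff by simp
    show "(case case p of (V, l) \<Rightarrow> (insert (hd l) V, tl l) of (V, l) \<Rightarrow>
        (if last_letter l > Min V then pos_weight x y (length l) else 1) * word_weight x y l) =
        (case p of (V, l) \<Rightarrow> word_weight x y l)"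
      using Vl m min by simp
  next
    fix p assume p: "p \<in> ?P (Suc k)"
    obtain V l where Vl: "p = (V, l)" by fastforce
    have V: "V \<in> signed_subsets A (Suc k)" and l: "l \<in> signed_words (A - abs ` V)"
      using p Vl by auto
    have fV: "finite V" "V \<noteq> {}" using V by (auto simp: signed_subsets_def)
    define a where "a = Min V"
    have a: "a \<in> V" using fV by (simp add: a_def)
    then have V': "V = insert a (V - {a})" by auto
    have "insert a (V - {a}) \<in> signed_subsets A (Suc k)" using V V' by simp
    then have aA: "\<bar>a\<bar> \<in> A" and sub: "V - {a} \<in> signed_subsets (A - {\<bar>a\<bar>}) k"
      using insert_in_signed_subsets_iff[of a "V - {a}"] by auto
    have sub': "V - {a} \<in> signed_subsets A k" and notin: "\<bar>a\<bar> \<notin> abs ` (V - {a})"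
      using sub by (auto simp: signed_subsets_def)
    have "card (V - {a}) = k" using sub by (simp add: signed_subsets_def)
    then have ne: "V - {a} \<noteq> {}" using assms(3) by (metis card.empty less_irrefl)
    have "A - abs ` V = A - abs ` (V - {a}) - {\<bar>a\<bar>}" using V' by blast
    then have word: "a # l \<in> signed_words (A - abs ` (V - {a}))"
      using l aA notin by (simp add: Cons_in_signed_words_iff)
    have "Min (V - {a}) \<in> V - {a}" using fV ne by (intro Min_in) auto
    then have "a < Min (V - {a})" using fV unfolding a_def by (metis DiffE Min_le insertI1 le_less)
    then show "(case p of (V, l) \<Rightarrow> (V - {Min V}, Min V # l)) \<in>
        {p \<in> ?P k. last_letter (snd p) < Min (fst p)}"
      using Vl sub' word by (simp add: a_def)
    show "(case case p of (V, l) \<Rightarrow> (V - {Min V}, Min V # l) of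
        (V, l) \<Rightarrow> (insert (hd l) V, tl l)) = p"
      using Vl V' by (simp add: a_def insert_absorb)
  qed
  finally show ?thesis .
qed

text \<open>The run uses every value, so the front is empty and the ascent starts from 0. All
  letters are then positive, which leaves only the increasing word on \<open>A\<close>, of weight
  1.\<close>

lemma sum_ascending_runs_full:
  fixes x y :: "'a::comm_ring_1"
  assumes "finite A" "A \<subseteq> {0<..}" "A \<noteq> {}"
  shows "(\<Sum>(V, l) \<in> (SIGMA V : signed_subsets A (card A). signed_words (A - abs ` V)).
      if last_letter l < Min V then word_weight x y l else 0) = 1"
proof -
  let ?P = "SIGMA V : signed_subsets A (card A). signed_words (A - abs ` V)"
  have abs_A: "abs ` A = A" using assms(2) by force
  have inj_A: "inj_on abs A" using assms(2) by (intro inj_onI) (metis abs_of_pos greaterThan_iff subsetD)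
  have fin: "finite ?P"
    using assms by (auto intro!: finite_signed_subsets finite_signed_words)
  have "{p \<in> ?P. last_letter (snd p) < Min (fst p)} = {(A, [])}"
  proof
    show "{(A, [])} \<subseteq> {p \<in> ?P. last_letter (snd p) < Min (fst p)}"
      using assms abs_A inj_A by (auto simp: signed_subsets_def Nil_in_signed_words_iff)
    show "{p \<in> ?P. last_letter (snd p) < Min (fst p)} \<subseteq> {(A, [])}"
    proof
      fix p assume p: "p \<in> {p \<in> ?P. last_letter (snd p) < Min (fst p)}"
      obtain V l where Vl: "p = (V, l)" by fastforce
      have V: "V \<in> signed_subsets A (card A)" and l: "l \<in> signed_words (A - abs ` V)"
        and less: "last_letter l < Min V"
        using p Vl by auto
      have "abs ` V = A"
        using V assms by (intro card_subset_eq) (auto simp: signed_subsets_def card_image)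
      then have "l = []" using l by (simp add: signed_words_empty)
      with less have "0 < Min V" by simp
      moreover have "finite V" using V by (simp add: signed_subsets_def)
      ultimately have "\<forall>v \<in> V. 0 < v" by (metis Min_le less_le_trans)
      then have "abs ` V = V" by force
      with \<open>abs ` V = A\<close> \<open>l = []\<close> show "p \<in> {(A, [])}" using Vl by simp
    qed
  qed
  then show ?thesis
    using sum.inter_filter[OF fin, of "\<lambda>p. word_weight x y (snd p)"
        "\<lambda>p. last_letter (snd p) < Min (fst p)"]
    by (simp add: case_prod_unfold)
qed

text \<open>The junction is at position \<open>card A - k\<close> and contributes
  \<open>w + (1 - w) [ascent]\<close>. The term \<open>w\<close> makes front and run independent;
  the ascent lengthens the run, or completes the word when the front is empty.\<close>

lemma run_sum_step:
  fixes x y :: "'a::comm_ring_1"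
  assumes "finite A" "A \<subseteq> {0<..}" "0 < k" "k \<le> card A"
  defines "w \<equiv> pos_weight x y (card A - k)"
  shows "run_sum x y A k = w * (\<Sum>V \<in> signed_subsets A k. word_sum x y (A - abs ` V)) +
    (1 - w) * (if k < card A then run_sum x y A (Suc k) else 1)"
proof -
  let ?P = "SIGMA V : signed_subsets A k. signed_words (A - abs ` V)"
  have "run_sum x y A k = (\<Sum>(V, l) \<in> ?P. w * word_weight x y l +
      (1 - w) * (if last_letter l < Min V then word_weight x y l else 0))"
    unfolding run_sum_def
  proof (intro sum.cong refl, clarify)
    fix V l assume V: "V \<in> signed_subsets A k" and l: "l \<in> signed_words (A - abs ` V)"
    have "length l = card A - k"
      using length_signed_words[OF l] card_Diff_signed_subset[OF assms(1) V] by simp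
    moreover have "last_letter l \<noteq> Min V"
      using last_letter_neq_Min V l assms by blast
    ultimately show "(if last_letter l > Min V then pos_weight x y (length l) else 1) *
        word_weight x y l = w * word_weight x y l +
        (1 - w) * (if last_letter l < Min V then word_weight x y l else 0)"
      by (auto simp: w_def algebra_simps)
  qed
  also have "\<dots> = w * (\<Sum>(V, l) \<in> ?P. word_weight x y l) +
      (1 - w) * (\<Sum>(V, l) \<in> ?P. if last_letter l < Min V then word_weight x y l else 0)"
    by (simp add: case_prod_unfold sum.distrib sum_distrib_left)
  also have "(\<Sum>(V, l) \<in> ?P. word_weight x y l) =
      (\<Sum>V \<in> signed_subsets A k. word_sum x y (A - abs ` V))"
    unfolding word_sum_def using assms
    by (subst sum.Sigma) (auto intro!: finite_signed_subsets finite_signed_words)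
  also have "(\<Sum>(V, l) \<in> ?P. if last_letter l < Min V then word_weight x y l else 0) =
      (if k < card A then run_sum x y A (Suc k) else 1)"
  proof (cases "k < card A")
    case True
    then show ?thesis using sum_ascending_runs assms by simp
  next
    case False
    then have "k = card A" "A \<noteq> {}" using assms by auto
    then show ?thesis using sum_ascending_runs_full assms by simp
  qed
  finally show ?thesis .
qed

section \<open>The recurrence for word sums\<close>

definition asc_prod :: "'a::comm_ring_1 \<Rightarrow> 'a \<Rightarrow> nat \<Rightarrow> nat \<Rightarrow> 'a" where
  "asc_prod x y n k = (\<Prod>j = 1..k. 1 - pos_weight x y (n - j))"

lemma word_sum_runs:
  fixes x y :: "'a::comm_ring_1"
  assumes "finite A" "A \<subseteq> {0<..}"
  defines "n \<equiv> card A"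
  shows "word_sum x y A = (\<Sum>k = 1..n. asc_prod x y n (k - 1) * pos_weight x y (n - k) *
    (\<Sum>V \<in> signed_subsets A k. word_sum x y (A - abs ` V))) + asc_prod x y n n"
proof (cases "n = 0")
  case True
  then have "A = {}" using assms by simp
  then show ?thesis
    using True by (simp add: word_sum_def signed_words_empty asc_prod_def)
next
  case False
  then have ne: "A \<noteq> {}" unfolding n_def by auto
  let ?T = "\<lambda>k. \<Sum>V \<in> signed_subsets A k. word_sum x y (A - abs ` V)"
  \<comment> \<open>This is the expansion stopped after \<open>m\<close> positions:
    \<open>m = 0\<close> is \<open>run_sum_1\<close>, each further step is
    \<open>run_sum_step\<close>, and at \<open>m = n\<close> the remainder is 1.\<close>
  have "word_sum x y A = (\<Sum>k = 1..m. asc_prod x y n (k - 1) * pos_weight x y (n - k) * ?T k) +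
      asc_prod x y n m * (if m < n then run_sum x y A (Suc m) else 1)" if "m \<le> n" for m
    using that
  proof (induction m)
    case 0
    then show ?case
      using False run_sum_1[OF assms(1) ne, of x y] by (simp add: asc_prod_def)
  next
    case (Suc m)
    then have m: "m < n" by simp
    have "asc_prod x y n (Suc m) = asc_prod x y n m * (1 - pos_weight x y (n - Suc m))"
      by (simp add: asc_prod_def)
    moreover have "run_sum x y A (Suc m) = pos_weight x y (n - Suc m) * ?T (Suc m) +
        (1 - pos_weight x y (n - Suc m)) * (if Suc m < n then run_sum x y A (Suc (Suc m)) else 1)"
      using run_sum_step[OF assms(1,2), of "Suc m" x y] m by (simp add: n_def)
    ultimately show ?case
      using Suc.IH m by (simp add: distrib_left mult.assoc del: if_split_asm)
  qed
  from this[of n] show ?thesis by simp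
qed

text \<open>Strong induction replaces an order-preserving relabelling: in
  \<open>word_sum_runs\<close> the number of runs depends only on the size of \<open>A\<close>, and
  the fronts are smaller since \<open>k \<ge> 1\<close>.\<close>

lemma word_sum_cong_card:
  fixes x y :: "'a::comm_ring_1"
  assumes "finite A" "A \<subseteq> {0<..}"
  shows "word_sum x y A = word_sum x y {1..int (card A)}"
  using assms
proof (induction "card A" arbitrary: A rule: less_induct)
  case less
  have *: "(\<Sum>V \<in> signed_subsets C k. word_sum x y (C - abs ` V)) =
      of_nat ((card A choose k) * 2 ^ k) * word_sum x y {1..int (card A - k)}"
    if "finite C" "C \<subseteq> {0<..}" "card C = card A" "k \<in> {1..card A}" for C k
  proof -
    have "(\<Sum>V \<in> signed_subsets C k. word_sum x y (C - abs ` V)) =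
        (\<Sum>V \<in> signed_subsets C k. word_sum x y {1..int (card A - k)})"
    proof (rule sum.cong[OF refl])
      fix V assume "V \<in> signed_subsets C k"
      then have "card (C - abs ` V) = card A - k"
        using that card_Diff_signed_subset by metis
      then show "word_sum x y (C - abs ` V) = word_sum x y {1..int (card A - k)}"
        using less.hyps[of "C - abs ` V"] that by auto
    qed
    then show ?thesis using that by (simp add: card_signed_subsets)
  qed
  have "{1..int (card A)} \<subseteq> {0<..}" by auto
  then show ?case
    using less.prems * word_sum_runs[of A x y] word_sum_runs[of "{1..int (card A)}" x y]
    by simp
qed

lemma word_sum_recurrence:
  fixes x y :: "'a::comm_ring_1"
  shows "word_sum x y {1..int n} = (\<Sum>k = 1..n. asc_prod x y n (k - 1) * pos_weight x y (n - k) *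
    (of_nat ((n choose k) * 2 ^ k) * word_sum x y {1..int (n - k)})) + asc_prod x y n n"
proof -
  let ?A = "{1..int n}"
  have A: "?A \<subseteq> {0<..}" "finite ?A" "card ?A = n" by auto
  have "(\<Sum>V \<in> signed_subsets ?A k. word_sum x y (?A - abs ` V)) =
      of_nat ((n choose k) * 2 ^ k) * word_sum x y {1..int (n - k)}" for k
  proof -
    have "(\<Sum>V \<in> signed_subsets ?A k. word_sum x y (?A - abs ` V)) =
        (\<Sum>V \<in> signed_subsets ?A k. word_sum x y {1..int (n - k)})"
    proof (rule sum.cong[OF refl])
      fix V assume V: "V \<in> signed_subsets ?A k"
      then have "card (?A - abs ` V) = n - k"
        using card_Diff_signed_subset[OF A(2) V] by simp
      then show "word_sum x y (?A - abs ` V) = word_sum x y {1..int (n - k)}"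
        using word_sum_cong_card[of "?A - abs ` V" x y] A by force
    qed
    then show ?thesis using A by (simp add: card_signed_subsets)
  qed
  then show ?thesis using word_sum_runs[OF A(2,1), of x y] A by simp
qed

section \<open>Signed permutations as words\<close>

text \<open>The letters are \<open>f m, ..., f 1\<close>, in the reversed order of the words above;
  \<open>f 0\<close> is left to the convention for \<open>last_letter []\<close>.\<close>

fun perm_word :: "(int \<Rightarrow> int) \<Rightarrow> nat \<Rightarrow> int list" where
  "perm_word f 0 = []"
| "perm_word f (Suc m) = f (int (Suc m)) # perm_word f m"

lemma length_perm_word [simp]: "length (perm_word f m) = m"
  by (induction m) auto

lemma atLeastAtMost_int_Suc: "{1..int (Suc m)} = insert (int (Suc m)) {1..int m}"
  by auto

lemma set_perm_word: "set (perm_word f m) = f ` {1..int m}"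
  by (induction m) (simp_all add: atLeastAtMost_int_Suc del: of_nat_Suc)

lemma distinct_perm_word: "distinct (perm_word f m) \<longleftrightarrow> inj_on f {1..int m}"
proof (induction m)
  case (Suc m)
  have "{1..int m} - {int (Suc m)} = {1..int m}" by auto
  with Suc show ?case
    by (auto simp: atLeastAtMost_int_Suc set_perm_word simp del: of_nat_Suc)
qed simp

lemma map_perm_word: "map g (perm_word f m) = perm_word (\<lambda>i. g (f i)) m"
  by (induction m) auto

lemma perm_word_eq_iff: "perm_word f m = perm_word g m \<longleftrightarrow> (\<forall>i \<in> {1..int m}. f i = g i)"
  by (induction m) (auto simp: atLeastAtMost_int_Suc simp del: of_nat_Suc)

lemma ex_perm_word: "\<exists>f. perm_word f (length l) = l"
proof (induction l)
  case (Cons a l)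
  then obtain f where f: "perm_word f (length l) = l" by blast
  have "perm_word (f(int (Suc (length l)) := a)) (length l) = perm_word f (length l)"
    by (simp add: perm_word_eq_iff)
  with f have "perm_word (f(int (Suc (length l)) := a)) (length (a # l)) = a # l" by simp
  then show ?case by blast
qed simp

lemma perm_word_in_signed_words_iff:
  "perm_word f n \<in> signed_words A \<longleftrightarrow>
    inj_on (\<lambda>i. \<bar>f i\<bar>) {1..int n} \<and> (\<lambda>i. \<bar>f i\<bar>) ` {1..int n} = A"
  by (simp add: signed_words_def map_perm_word distinct_perm_word set_perm_word image_image)

lemma descents_Suc:
  "descents (Suc m) \<sigma> =
    (if \<sigma> (int m) > \<sigma> (int (Suc m)) then insert m (descents m \<sigma>) else descents m \<sigma>)"
  by (auto simp: descents_def less_Suc_eq)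

lemma word_weight_perm_word:
  assumes "\<sigma> 0 = 0"
  shows "word_weight x y (perm_word \<sigma> m) = x ^ des1 m \<sigma> * y ^ des0 m \<sigma>"
proof (induction m)
  case 0
  then show ?case by (simp add: des1_def des0_def descents_def)
next
  case (Suc m)
  \<comment> \<open>For \<open>m = 0\<close> the word is empty, and \<open>\<sigma> 0 = 0\<close>
    matches the default value of \<open>last_letter\<close>.\<close>
  have last: "last_letter (perm_word \<sigma> m) = \<sigma> (int m)" using assms by (cases m) auto
  have "m \<notin> descents m \<sigma>" "finite (descents m \<sigma>)" by (simp_all add: descents_def)
  moreover have "{i \<in> insert m (descents m \<sigma>). P i} =
      (if P m then insert m {i \<in> descents m \<sigma>. P i} else {i \<in> descents m \<sigma>. P i})" for P
    by auto
  ultimately have "card {i \<in> insert m (descents m \<sigma>). P i} =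
      (if P m then Suc (card {i \<in> descents m \<sigma>. P i}) else card {i \<in> descents m \<sigma>. P i})" for P
    by simp
  then show ?case
    using Suc last
    by (simp add: des1_def des0_def descents_Suc pos_weight_def mult_ac del: of_nat_Suc insert_iff)
qed

text \<open>Oddness determines a signed permutation from its values on the positive integers up to
  \<open>n\<close>; conversely, a signed word has an odd extension.\<close>

lemma bij_betw_perm_word:
  "bij_betw (\<lambda>\<sigma>. perm_word \<sigma> n) (signed_perms n) (signed_words {1..int n})"
  unfolding bij_betw_def
proof
  let ?S = "{- int n..int n} - {0}"
  show "inj_on (\<lambda>\<sigma>. perm_word \<sigma> n) (signed_perms n)"
  proof (rule inj_onI, rule ext)
    fix \<sigma> \<tau> i
    assume \<sigma>: "\<sigma> \<in> signed_perms n" and \<tau>: "\<tau> \<in> signed_perms n"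
      and "perm_word \<sigma> n = perm_word \<tau> n"
    then have eq: "\<sigma> j = \<tau> j" if "j \<in> {1..int n}" for j
      using that by (simp add: perm_word_eq_iff)
    consider "i \<in> {1..int n}" | "- i \<in> {1..int n}" | "i \<notin> ?S" by force
    then show "\<sigma> i = \<tau> i"
    proof cases
      case 2
      have "\<rho> i = - \<rho> (- i)" if "\<rho> \<in> signed_perms n" for \<rho>
        using that 2 unfolding signed_perms_def by force
      then show ?thesis using eq[OF 2] \<sigma> \<tau> by metis
    next
      case 3
      then show ?thesis using \<sigma> \<tau> by (simp add: signed_perms_def permutes_def)
    qed (rule eq)
  qed
  show "(\<lambda>\<sigma>. perm_word \<sigma> n) ` signed_perms n = signed_words {1..int n}"
  proof
    show "(\<lambda>\<sigma>. perm_word \<sigma> n) ` signed_perms n \<subseteq> signed_words {1..int n}"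
    proof
      fix l assume "l \<in> (\<lambda>\<sigma>. perm_word \<sigma> n) ` signed_perms n"
      then obtain \<sigma> where l: "l = perm_word \<sigma> n" and perm: "\<sigma> permutes ?S"
        and odd: "\<And>i. i \<in> ?S \<Longrightarrow> \<sigma> (- i) = - \<sigma> i"
        by (auto simp: signed_perms_def)
      have "inj_on (\<lambda>i. \<bar>\<sigma> i\<bar>) {1..int n}"
      proof (rule inj_onI)
        fix i j assume ij: "i \<in> {1..int n}" "j \<in> {1..int n}" "\<bar>\<sigma> i\<bar> = \<bar>\<sigma> j\<bar>"
        then have "\<sigma> i = \<sigma> j \<or> \<sigma> i = \<sigma> (- j)" using odd[of j] by (auto simp: abs_eq_iff)
        then have "i = j \<or> i = - j" using permutes_inj[OF perm] by (auto dest: injD)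
        then show "i = j" using ij by auto
      qed
      \<comment> \<open>An injective map of a finite set into itself is onto, so inclusion
        suffices.\<close>
      moreover have "(\<lambda>i. \<bar>\<sigma> i\<bar>) ` {1..int n} \<subseteq> {1..int n}"
      proof (rule image_subsetI)
        fix i assume "i \<in> {1..int n}"
        then have "\<sigma> i \<in> ?S" using permutes_in_image[OF perm, of i] by simp
        then show "\<bar>\<sigma> i\<bar> \<in> {1..int n}" by auto
      qed
      ultimately show "l \<in> signed_words {1..int n}"
        by (simp add: l perm_word_in_signed_words_iff endo_inj_surj)
    qed
    show "signed_words {1..int n} \<subseteq> (\<lambda>\<sigma>. perm_word \<sigma> n) ` signed_perms n"
    proof
      fix l assume l: "l \<in> signed_words {1..int n}"
      then have "length l = n" by (simp add: length_signed_words)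
      then obtain f where f: "perm_word f n = l" using ex_perm_word by metis
      have inj: "inj_on (\<lambda>i. \<bar>f i\<bar>) {1..int n}" and im: "(\<lambda>i. \<bar>f i\<bar>) ` {1..int n} = {1..int n}"
        using l unfolding f[symmetric] perm_word_in_signed_words_iff by auto
      have f_range: "\<bar>f i\<bar> \<in> {1..int n}" if "i \<in> {1..int n}" for i using im that by blast
      define \<sigma> where "\<sigma> i = (if i \<in> {1..int n} then f i
        else if - i \<in> {1..int n} then - f (- i) else i)" for i
      have S_iff: "i \<in> ?S \<longleftrightarrow> \<bar>i\<bar> \<in> {1..int n}" for i by auto
      \<comment> \<open>In this form the absolute value of \<open>\<sigma> i\<close> determines that
        of \<open>i\<close>, and the nonzero factor \<open>f \<bar>i\<bar>\<close> can be cancelled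
        to recover the sign.\<close>
      have \<sigma>_eq: "\<sigma> i = sgn i * f \<bar>i\<bar>" if "i \<in> ?S" for i
        using that by (auto simp: \<sigma>_def sgn_if)
      have abs_\<sigma>: "\<bar>\<sigma> i\<bar> = \<bar>f \<bar>i\<bar>\<bar>" if "i \<in> ?S" for i
        using that \<sigma>_eq[OF that] by (auto simp: abs_mult)
      have "inj_on \<sigma> ?S"
      proof (rule inj_onI)
        fix i j assume ij: "i \<in> ?S" "j \<in> ?S" "\<sigma> i = \<sigma> j"
        then have "\<bar>f \<bar>i\<bar>\<bar> = \<bar>f \<bar>j\<bar>\<bar>" using abs_\<sigma> by metis
        then have abs_eq: "\<bar>i\<bar> = \<bar>j\<bar>" using ij inj S_iff by (auto dest: inj_onD)
        moreover have "f \<bar>i\<bar> \<noteq> 0" using f_range[of "\<bar>i\<bar>"] ij S_iff by fastforce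
        ultimately have "sgn i = sgn j" using ij \<sigma>_eq by simp
        with abs_eq show "i = j" by (metis sgn_mult_abs)
      qed
      moreover have "\<sigma> ` ?S \<subseteq> ?S"
      proof (rule image_subsetI)
        fix i assume i: "i \<in> ?S"
        show "\<sigma> i \<in> ?S"
          using abs_\<sigma>[OF i] f_range[of "\<bar>i\<bar>"] i unfolding S_iff by simp
      qed
      ultimately have "bij_betw \<sigma> ?S ?S" by (simp add: bij_betw_def endo_inj_surj)
      then have "\<sigma> permutes ?S" by (rule bij_imp_permutes) (auto simp: \<sigma>_def)
      moreover have "\<sigma> (- i) = - \<sigma> i" if "i \<in> ?S" for i
        using that \<sigma>_eq[of i] \<sigma>_eq[of "- i"] by (simp add: sgn_minus)
      ultimately have "\<sigma> \<in> signed_perms n" by (simp add: signed_perms_def)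
      moreover have "perm_word \<sigma> n = l" using f by (auto simp: \<sigma>_def perm_word_eq_iff)
      ultimately show "l \<in> (\<lambda>\<sigma>. perm_word \<sigma> n) ` signed_perms n" by blast
    qed
  qed
qed

lemma B_eq_word_sum: "B n x y = word_sum x y {1..int n}"
proof -
  have "\<sigma> 0 = 0" if "\<sigma> \<in> signed_perms n" for \<sigma>
    using that by (simp add: signed_perms_def permutes_def)
  then have "B n x y = (\<Sum>\<sigma> \<in> signed_perms n. word_weight x y (perm_word \<sigma> n))"
    by (simp add: B_def word_weight_perm_word)
  also have "\<dots> = word_sum x y {1..int n}"
    unfolding word_sum_def by (rule sum.reindex_bij_betw[OF bij_betw_perm_word])
  finally show ?thesis .
qed

section \<open>The recurrence for \<open>B\<close>\<close>

text \<open>Neighbouring positions have opposite parities, so each pair contributes \<alpha>. For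
  odd \<open>k\<close> one factor remains, with the parity of position \<open>n - 1\<close>.\<close>

lemma asc_prod_eq:
  fixes x y :: "'a::comm_ring_1"
  assumes "k \<le> n"
  shows "asc_prod x y n k = ((1 - x) * (1 - y)) ^ (k div 2) *
    (if odd k then 1 - (if even n then x else y) else 1)"
  using assms
proof (induction k)
  case 0
  then show ?case by (simp add: asc_prod_def)
next
  case (Suc k)
  have "asc_prod x y n (Suc k) = asc_prod x y n k * (1 - pos_weight x y (n - Suc k))"
    by (simp add: asc_prod_def)
  moreover have "odd (n - Suc k) \<longleftrightarrow> even n \<longleftrightarrow> even k" using Suc.prems by auto
  ultimately show ?case
    using Suc by (auto simp: pos_weight_def mult_ac)
qed

text \<open>Here \<open>u n\<close> and \<open>v n\<close> are the weights of positions with the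
  parity of \<open>n - 1\<close> and of \<open>n\<close>. Dividing by \<open>fact n\<close> and
  adding a zero summand at \<open>k = 0\<close> gives a Cauchy product.\<close>

lemma B_recurrence:
  fixes x y :: "'a::field_char_0"
  defines "\<alpha> \<equiv> (1 - x) * (1 - y)"
  defines "u n \<equiv> (if even n then x else y)" and "v n \<equiv> (if even n then y else x)"
  shows "(1 - v n) * (B n x y / fact n) =
    (\<Sum>k = 0..n. (if k = 0 then 0 else if odd k then (1 - v n) * u n else v n) *
       (\<alpha> ^ (k div 2) * 2 ^ k / fact k) * (B (n - k) x y / fact (n - k))) +
    (1 - v n) * (\<alpha> ^ (n div 2) * (if odd n then 1 - y else 1) / fact n)"
proof -
  have \<alpha>: "\<alpha> = (1 - u n) * (1 - v n)" by (simp add: \<alpha>_def u_def v_def mult.commute)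
  have "(1 - v n) * (B n x y / fact n) =
      (\<Sum>k = 1..n. (1 - v n) * (asc_prod x y n (k - 1) * pos_weight x y (n - k) *
        (of_nat ((n choose k) * 2 ^ k) * B (n - k) x y)) / fact n) +
      (1 - v n) * (asc_prod x y n n / fact n)"
    using word_sum_recurrence[of x y n]
    by (simp add: B_eq_word_sum add_divide_distrib distrib_left sum_distrib_left sum_divide_distrib)
  also have "asc_prod x y n n = \<alpha> ^ (n div 2) * (if odd n then 1 - y else 1)"
    by (simp add: asc_prod_eq \<alpha>_def)
  also have "(\<Sum>k = 1..n. (1 - v n) * (asc_prod x y n (k - 1) * pos_weight x y (n - k) *
        (of_nat ((n choose k) * 2 ^ k) * B (n - k) x y)) / fact n) =
      (\<Sum>k = 1..n. (if k = 0 then 0 else if odd k then (1 - v n) * u n else v n) *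
       (\<alpha> ^ (k div 2) * 2 ^ k / fact k) * (B (n - k) x y / fact (n - k)))"
  proof (rule sum.cong[OF refl])
    fix k assume k: "k \<in> {1..n}"
    have choose: "of_nat (n choose k) = (fact n / (fact k * fact (n - k)) :: 'a)"
      using k by (simp add: binomial_fact)
    have "pos_weight x y (n - k) = (if odd k then u n else v n)"
      using k by (auto simp: pos_weight_def u_def v_def)
    moreover have "asc_prod x y n (k - 1) = \<alpha> ^ ((k - 1) div 2) * (if even k then 1 - u n else 1)"
      using k asc_prod_eq[of "k - 1" n x y] by (auto simp: \<alpha>_def u_def)
    \<comment> \<open>For even \<open>k\<close> the product before the chosen weight lacks a factor
      \<open>1 - v n\<close> to be a full power of \<alpha>; this is why the recurrence is
      multiplied by it.\<close>
    moreover have "\<alpha> ^ (k div 2) = \<alpha> ^ ((k - 1) div 2) * (if even k then (1 - u n) * (1 - v n) else 1)"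
    proof (cases "even k")
      case True
      then have "k div 2 = Suc ((k - 1) div 2)" using k by (elim evenE) auto
      then show ?thesis using True by (simp add: \<alpha> mult_ac)
    next
      case False
      then have "(k - 1) div 2 = k div 2" by (elim oddE) auto
      then show ?thesis using False by simp
    qed
    ultimately show "(1 - v n) * (asc_prod x y n (k - 1) * pos_weight x y (n - k) *
        (of_nat ((n choose k) * 2 ^ k) * B (n - k) x y)) / fact n =
      (if k = 0 then 0 else if odd k then (1 - v n) * u n else v n) *
       (\<alpha> ^ (k div 2) * 2 ^ k / fact k) * (B (n - k) x y / fact (n - k))"
      using k by (simp add: choose field_simps)
  qed
  also have "\<dots> = (\<Sum>k = 0..n. (if k = 0 then 0 else if odd k then (1 - v n) * u n else v n) *
       (\<alpha> ^ (k div 2) * 2 ^ k / fact k) * (B (n - k) x y / fact (n - k)))"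
    by (simp add: sum.atLeast_Suc_atMost[of 0 n])
  finally show ?thesis .
qed

section \<open>Hyperbolic power series\<close>

text \<open>
  These are \<open>cosh (c \<surd>\<alpha> t)\<close> and \<open>sinh (c \<surd>\<alpha> t) / \<surd>\<alpha>\<close>; their identities are derived from
  differential equations because \<open>\<surd>\<alpha>\<close> need not exist.
\<close>

definition cosh_fps :: "'a::field_char_0 \<Rightarrow> 'a \<Rightarrow> 'a fps" where
  "cosh_fps \<alpha> c = even_fps (\<lambda>n. \<alpha> ^ n * c ^ (2 * n) / fact (2 * n))"

definition sinh_fps :: "'a::field_char_0 \<Rightarrow> 'a \<Rightarrow> 'a fps" where
  "sinh_fps \<alpha> c = odd_fps (\<lambda>n. \<alpha> ^ n * c ^ (2 * n + 1) / fact (2 * n + 1))"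

lemma fps_deriv_cosh_fps: "fps_deriv (cosh_fps \<alpha> c) = fps_const (\<alpha> * c) * sinh_fps \<alpha> c"
proof (rule fps_ext)
  fix m
  show "fps_nth (fps_deriv (cosh_fps \<alpha> c)) m = fps_nth (fps_const (\<alpha> * c) * sinh_fps \<alpha> c) m"
  proof (cases "odd m")
    case True
    then obtain k where "m = 2 * k + 1" by (elim oddE)
    then show ?thesis
      by (simp add: cosh_fps_def sinh_fps_def even_fps_def odd_fps_def divide_simps del: of_nat_Suc)
  qed (simp add: cosh_fps_def sinh_fps_def even_fps_def odd_fps_def)
qed

lemma fps_deriv_sinh_fps: "fps_deriv (sinh_fps \<alpha> c) = fps_const c * cosh_fps \<alpha> c"
proof (rule fps_ext)
  fix m
  show "fps_nth (fps_deriv (sinh_fps \<alpha> c)) m = fps_nth (fps_const c * cosh_fps \<alpha> c) m"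
  proof (cases "even m")
    case True
    then obtain k where "m = 2 * k" by (elim evenE)
    then show ?thesis
      by (simp add: cosh_fps_def sinh_fps_def even_fps_def odd_fps_def divide_simps del: of_nat_Suc)
  qed (simp add: cosh_fps_def sinh_fps_def even_fps_def odd_fps_def)
qed

lemma cosh_sinh_fps_0 [simp]:
  "fps_nth (cosh_fps \<alpha> c) 0 = 1" "fps_nth (sinh_fps \<alpha> c) 0 = 0"
  by (simp_all add: cosh_fps_def sinh_fps_def even_fps_def odd_fps_def)

text \<open>The equations give each coefficient from the previous one, dividing by
  \<open>Suc n\<close>, so the constant terms determine both series.\<close>

lemma fps_linear_system_unique:
  fixes p q p' q' :: "'a::field_char_0 fps"
  assumes "fps_deriv p = fps_const a * q" "fps_deriv q = p"
    and "fps_deriv p' = fps_const a * q'" "fps_deriv q' = p'"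
    and "fps_nth p 0 = fps_nth p' 0" "fps_nth q 0 = fps_nth q' 0"
  shows "p = p'" "q = q'"
proof -
  have "fps_nth p n = fps_nth p' n \<and> fps_nth q n = fps_nth q' n" for n
  proof (induction n)
    case (Suc n)
    have *: "fps_nth f (Suc n) = fps_nth (fps_deriv f) n / of_nat (Suc n)" for f :: "'a fps"
      by (simp add: field_simps del: of_nat_Suc)
    show ?case using Suc assms(1-4) by (simp add: *)
  qed (use assms in simp)
  then show "p = p'" "q = q'" by (auto intro: fps_ext)
qed

lemma cosh_fps_square: "cosh_fps \<alpha> c ^ 2 - fps_const \<alpha> * sinh_fps \<alpha> c ^ 2 = 1"
proof -
  have "fps_deriv (cosh_fps \<alpha> c ^ 2 - fps_const \<alpha> * sinh_fps \<alpha> c ^ 2) = 0"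
    by (simp add: power2_eq_square fps_deriv_cosh_fps fps_deriv_sinh_fps algebra_simps
        flip: fps_const_mult)
  then show ?thesis
    by (subst (asm) fps_deriv_eq_0_iff) (simp add: power2_eq_square)
qed

text \<open>Both sides solve \<open>p' = \<alpha> q\<close>, \<open>q' = p\<close> with the initial
  values 1 and 0.\<close>

lemma cosh_sinh_fps_2_diff_1:
  fixes \<alpha> :: "'a::field_char_0"
  shows "cosh_fps \<alpha> 2 * cosh_fps \<alpha> 1 - fps_const \<alpha> * sinh_fps \<alpha> 2 * sinh_fps \<alpha> 1 = cosh_fps \<alpha> 1"
    and "sinh_fps \<alpha> 2 * cosh_fps \<alpha> 1 - cosh_fps \<alpha> 2 * sinh_fps \<alpha> 1 = sinh_fps \<alpha> 1"
proof -
  have two: "fps_const (\<alpha> * 2) = 2 * fps_const \<alpha>" "fps_const (2::'a) = 2"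
    by (simp_all add: numeral_fps_const)
  show "cosh_fps \<alpha> 2 * cosh_fps \<alpha> 1 - fps_const \<alpha> * sinh_fps \<alpha> 2 * sinh_fps \<alpha> 1 = cosh_fps \<alpha> 1"
    and "sinh_fps \<alpha> 2 * cosh_fps \<alpha> 1 - cosh_fps \<alpha> 2 * sinh_fps \<alpha> 1 = sinh_fps \<alpha> 1"
    by (rule fps_linear_system_unique[where a = \<alpha>
          and p = "cosh_fps \<alpha> 2 * cosh_fps \<alpha> 1 - fps_const \<alpha> * sinh_fps \<alpha> 2 * sinh_fps \<alpha> 1"
          and q = "sinh_fps \<alpha> 2 * cosh_fps \<alpha> 1 - cosh_fps \<alpha> 2 * sinh_fps \<alpha> 1"
          and p' = "cosh_fps \<alpha> 1" and q' = "sinh_fps \<alpha> 1"];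
        simp add: fps_deriv_cosh_fps fps_deriv_sinh_fps two algebra_simps)+
qed

text \<open>Cramer's rule: by \<open>sq\<close>, the determinant \<open>(1 - x * C) * (1 - y * C) -
  (1 - x) * (1 - y) * x * y * S ^ 2\<close> equals \<open>1 + x * y - (x + y) * C\<close>. The
  hypotheses \<open>c\<close> and \<open>s\<close> simplify the right-hand sides.\<close>

lemma
  fixes x y E O' S C c s :: "'a::comm_ring_1"
  assumes E: "(1 - y) * E = (1 - y) * x * S * O' + y * (C - 1) * E + (1 - y) * c"
    and O: "(1 - x) * O' = (1 - x) * y * S * E + x * (C - 1) * O' + (1 - x) * (1 - y) * s"
    and sq: "C ^ 2 - (1 - x) * (1 - y) * S ^ 2 = 1"
    and c: "C * c - (1 - x) * (1 - y) * S * s = c"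
    and s: "S * c - C * s = s"
  shows linear_system_even: "E * (1 + x * y - (x + y) * C) = (1 - x) * (1 - y) * c"
    and linear_system_odd: "O' * (1 + x * y - (x + y) * C) = (1 - x) * (1 - y) * (1 + y) * s"
proof -
  let ?e = "(1 - y) * E - ((1 - y) * x * S * O' + y * (C - 1) * E + (1 - y) * c)"
  let ?o = "(1 - x) * O' - ((1 - x) * y * S * E + x * (C - 1) * O' + (1 - x) * (1 - y) * s)"
  let ?q = "C ^ 2 - (1 - x) * (1 - y) * S ^ 2 - 1"
  \<comment> \<open>The multipliers of \<open>?e\<close> and \<open>?o\<close> cancel
    \<open>O'\<close>; the last two terms insert \<open>sq\<close> and \<open>c\<close>.\<close>
  have "E * (1 + x * y - (x + y) * C) - (1 - x) * (1 - y) * c =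
      (1 - x * C) * ?e + (1 - y) * x * S * ?o - x * y * E * ?q -
      (1 - y) * x * (C * c - (1 - x) * (1 - y) * S * s - c)"
    by (simp add: algebra_simps power2_eq_square)
  also have "\<dots> = 0" using assms by simp
  finally show "E * (1 + x * y - (x + y) * C) = (1 - x) * (1 - y) * c" by simp
  have "O' * (1 + x * y - (x + y) * C) - (1 - x) * (1 - y) * (1 + y) * s =
      (1 - y * C) * ?o + (1 - x) * y * S * ?e - x * y * O' * ?q +
      (1 - x) * (1 - y) * y * (S * c - C * s - s)"
    by (simp add: algebra_simps power2_eq_square)
  also have "\<dots> = 0" using assms by simp
  finally show "O' * (1 + x * y - (x + y) * C) = (1 - x) * (1 - y) * (1 + y) * s" by simp
qed

section \<open>Generating functions\<close>

lemma cosh_fps_nth: "fps_nth (cosh_fps \<alpha> c) m = (if even m then \<alpha> ^ (m div 2) * c ^ m / fact m else 0)"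
  by (auto simp: cosh_fps_def even_fps_def)

lemma sinh_fps_nth: "fps_nth (sinh_fps \<alpha> c) m = (if odd m then \<alpha> ^ (m div 2) * c ^ m / fact m else 0)"
  by (auto simp: sinh_fps_def odd_fps_def elim!: oddE)

definition B_even_fps :: "'a::field_char_0 \<Rightarrow> 'a \<Rightarrow> 'a fps" where
  "B_even_fps x y = even_fps (\<lambda>n. B (2 * n) x y / fact (2 * n))"

definition B_odd_fps :: "'a::field_char_0 \<Rightarrow> 'a \<Rightarrow> 'a fps" where
  "B_odd_fps x y = odd_fps (\<lambda>n. B (2 * n + 1) x y / fact (2 * n + 1))"

lemma B_even_fps_nth: "fps_nth (B_even_fps x y) m = (if even m then B m x y / fact m else 0)"
  by (auto simp: B_even_fps_def even_fps_def)

lemma B_odd_fps_nth: "fps_nth (B_odd_fps x y) m = (if odd m then B m x y / fact m else 0)"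
  by (auto simp: B_odd_fps_def odd_fps_def elim!: oddE)

text \<open>At even \<open>n\<close>, the odd \<open>k\<close> in \<open>B_recurrence\<close> pair
  \<open>sinh_fps\<close> with the odd series and the even \<open>k\<close> pair
  \<open>cosh_fps\<close> with the even one. Subtracting 1 drops \<open>k = 0\<close>. At odd
  \<open>n\<close> all terms vanish by parity.\<close>

lemma B_even_fps_system:
  fixes x y :: "'a::field_char_0"
  defines "\<alpha> \<equiv> (1 - x) * (1 - y)"
  shows "fps_const (1 - y) * B_even_fps x y =
    fps_const ((1 - y) * x) * (sinh_fps \<alpha> 2 * B_odd_fps x y) +
    fps_const y * ((cosh_fps \<alpha> 2 - 1) * B_even_fps x y) + fps_const (1 - y) * cosh_fps \<alpha> 1"
    (is "?L = ?R")
proof (rule fps_ext)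
  fix n
  have R: "fps_nth ?R n = (\<Sum>k = 0..n.
      (1 - y) * x * (fps_nth (sinh_fps \<alpha> 2) k * fps_nth (B_odd_fps x y) (n - k)) +
      y * (fps_nth (cosh_fps \<alpha> 2 - 1) k * fps_nth (B_even_fps x y) (n - k))) +
      (1 - y) * fps_nth (cosh_fps \<alpha> 1) n"
    unfolding fps_add_nth fps_mult_left_const_nth fps_mult_nth[of "sinh_fps \<alpha> 2"]
      fps_mult_nth[of "cosh_fps \<alpha> 2 - 1"]
    by (simp add: sum_distrib_left sum.distrib)
  show "fps_nth ?L n = fps_nth ?R n"
  proof (cases "even n")
    case False
    then show ?thesis
      unfolding R by (auto simp: cosh_fps_nth sinh_fps_nth B_even_fps_nth B_odd_fps_nth
          intro!: sum.neutral)
  next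
    case True
    then have "(1 - y) * (B n x y / fact n) =
        (\<Sum>k = 0..n. (if k = 0 then 0 else if odd k then (1 - y) * x else y) *
          (\<alpha> ^ (k div 2) * 2 ^ k / fact k) * (B (n - k) x y / fact (n - k))) +
        (1 - y) * fps_nth (cosh_fps \<alpha> 1) n"
      using B_recurrence[where n = n and x = x and y = y] by (simp add: \<alpha>_def cosh_fps_nth)
    then show ?thesis
      unfolding R using True
      by (auto simp: cosh_fps_nth sinh_fps_nth B_even_fps_nth B_odd_fps_nth intro!: sum.cong)
  qed
qed

text \<open>At odd \<open>n\<close> the roles of \<open>x\<close> and \<open>y\<close> are
  exchanged, and the increasing word brings the unpaired factor \<open>1 - y\<close> of position
  0.\<close>

lemma B_odd_fps_system:
  fixes x y :: "'a::field_char_0"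
  defines "\<alpha> \<equiv> (1 - x) * (1 - y)"
  shows "fps_const (1 - x) * B_odd_fps x y =
    fps_const ((1 - x) * y) * (sinh_fps \<alpha> 2 * B_even_fps x y) +
    fps_const x * ((cosh_fps \<alpha> 2 - 1) * B_odd_fps x y) +
    fps_const ((1 - x) * (1 - y)) * sinh_fps \<alpha> 1"
    (is "?L = ?R")
proof (rule fps_ext)
  fix n
  have R: "fps_nth ?R n = (\<Sum>k = 0..n.
      (1 - x) * y * (fps_nth (sinh_fps \<alpha> 2) k * fps_nth (B_even_fps x y) (n - k)) +
      x * (fps_nth (cosh_fps \<alpha> 2 - 1) k * fps_nth (B_odd_fps x y) (n - k))) +
      (1 - x) * (1 - y) * fps_nth (sinh_fps \<alpha> 1) n"
    unfolding fps_add_nth fps_mult_left_const_nth fps_mult_nth[of "sinh_fps \<alpha> 2"]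
      fps_mult_nth[of "cosh_fps \<alpha> 2 - 1"]
    by (simp add: sum_distrib_left sum.distrib)
  show "fps_nth ?L n = fps_nth ?R n"
  proof (cases "odd n")
    case False
    then show ?thesis
      unfolding R by (auto simp: cosh_fps_nth sinh_fps_nth B_even_fps_nth B_odd_fps_nth
          intro!: sum.neutral)
  next
    case True
    then have "(1 - x) * (B n x y / fact n) =
        (\<Sum>k = 0..n. (if k = 0 then 0 else if odd k then (1 - x) * y else x) *
          (\<alpha> ^ (k div 2) * 2 ^ k / fact k) * (B (n - k) x y / fact (n - k))) +
        (1 - x) * (1 - y) * fps_nth (sinh_fps \<alpha> 1) n"
      using B_recurrence[where n = n and x = x and y = y] by (simp add: \<alpha>_def sinh_fps_nth mult_ac)
    then show ?thesis
      unfolding R using True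
      by (auto simp: cosh_fps_nth sinh_fps_nth B_even_fps_nth B_odd_fps_nth intro!: sum.cong)
  qed
qed

lemma
  fixes x y :: "'a::field_char_0"
  defines "\<alpha> \<equiv> (1 - x) * (1 - y)"
  shows B_even_fps_mult: "B_even_fps x y * (fps_const (1 + x * y) - fps_const (x + y) * cosh_fps \<alpha> 2) =
      fps_const \<alpha> * cosh_fps \<alpha> 1"
    and B_odd_fps_mult: "B_odd_fps x y * (fps_const (1 + x * y) - fps_const (x + y) * cosh_fps \<alpha> 2) =
      fps_const (\<alpha> * (1 + y)) * sinh_fps \<alpha> 1"
proof -
  let ?X = "fps_const x" and ?Y = "fps_const y"
  \<comment> \<open>Constants are expanded in \<open>?X\<close> and \<open>?Y\<close> so that the
    elimination applies in the ring of power series.\<close>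
  have const: "fps_const (1 - x) = 1 - ?X" "fps_const (1 - y) = 1 - ?Y"
    "fps_const \<alpha> = (1 - ?X) * (1 - ?Y)" "fps_const (1 + x * y) = 1 + ?X * ?Y"
    "fps_const (x + y) = ?X + ?Y" "fps_const ((1 - y) * x) = (1 - ?Y) * ?X"
    "fps_const ((1 - x) * y) = (1 - ?X) * ?Y"
    "fps_const ((1 - x) * (1 - y)) = (1 - ?X) * (1 - ?Y)"
    "fps_const (\<alpha> * (1 + y)) = (1 - ?X) * (1 - ?Y) * (1 + ?Y)"
    by (simp_all add: \<alpha>_def fps_const_1_eq_1[symmetric] del: fps_const_1_eq_1)
  note system = B_even_fps_system[where x = x and y = y, folded \<alpha>_def, unfolded const, folded mult.assoc]
    B_odd_fps_system[where x = x and y = y, folded \<alpha>_def, unfolded const, folded mult.assoc]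
    cosh_fps_square[of \<alpha> 2, unfolded const] cosh_sinh_fps_2_diff_1[of \<alpha>, unfolded const]
  show "B_even_fps x y * (fps_const (1 + x * y) - fps_const (x + y) * cosh_fps \<alpha> 2) =
      fps_const \<alpha> * cosh_fps \<alpha> 1"
    unfolding const by (rule linear_system_even[OF system])
  show "B_odd_fps x y * (fps_const (1 + x * y) - fps_const (x + y) * cosh_fps \<alpha> 2) =
      fps_const (\<alpha> * (1 + y)) * sinh_fps \<alpha> 1"
    unfolding const by (rule linear_system_odd[OF system])
qed

theorem theorem1p2:
  fixes x y \<alpha> :: ratfun
  defines "x \<equiv> indet_x" and "y \<equiv> indet_y"
  defines "\<alpha> \<equiv> (1 - x) * (1 - y)"
  shows "even_fps (\<lambda>n. if n \<ge> 1 then B (2 * n) x y / fact (2 * n) else 0) =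
      (fps_const (x + y) * even_fps (\<lambda>n. \<alpha> ^ n * 2 ^ (2 * n) / fact (2 * n))
         + even_fps (\<lambda>n. \<alpha> ^ (n + 1) / fact (2 * n)) - fps_const (1 + x * y))
      / (fps_const (1 + x * y)
         - fps_const (x + y) * even_fps (\<lambda>n. \<alpha> ^ n * 2 ^ (2 * n) / fact (2 * n)))
    \<and> odd_fps (\<lambda>n. B (2 * n + 1) x y / fact (2 * n + 1)) =
      (fps_const ((y ^ 2 - 1) * (x - 1)) * odd_fps (\<lambda>n. \<alpha> ^ n / fact (2 * n + 1)))
      / (fps_const (1 + x * y)
         - fps_const (x + y) * even_fps (\<lambda>n. \<alpha> ^ n * 2 ^ (2 * n) / fact (2 * n)))"
proof -
  define D where "D = fps_const (1 + x * y) - fps_const (x + y) * cosh_fps \<alpha> 2"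
  have D_eq: "fps_const (1 + x * y)
      - fps_const (x + y) * even_fps (\<lambda>n. \<alpha> ^ n * 2 ^ (2 * n) / fact (2 * n)) = D"
    by (simp add: D_def cosh_fps_def)
  \<comment> \<open>The constant term is \<open>(1 + x * y) - (x + y)\<close>, since
    \<open>cosh_fps\<close> starts with 1; hence \<open>D\<close> can be cancelled in the
    quotients.\<close>
  have "fps_nth D 0 \<noteq> 0"
    using denominator_const_nonzero by (simp add: D_def x_def y_def)
  then have D: "D \<noteq> 0" by auto
  \<comment> \<open>The sum in the claim starts at \<open>n = 1\<close>, so it is the full even
    series minus this constant term.\<close>
  have "B 0 x y = 1"
    using word_sum_recurrence[of x y 0] by (simp add: B_eq_word_sum asc_prod_def)
  then have even: "even_fps (\<lambda>n. if n \<ge> 1 then B (2 * n) x y / fact (2 * n) else 0) = B_even_fps x y - 1"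
    by (intro fps_ext) (auto simp: B_even_fps_def even_fps_def elim!: evenE)
  have "even_fps (\<lambda>n. \<alpha> ^ (n + 1) / fact (2 * n)) = fps_const \<alpha> * cosh_fps \<alpha> 1"
    by (intro fps_ext) (simp add: cosh_fps_def even_fps_def)
  \<comment> \<open>The numerator is \<open>fps_const \<alpha> * cosh_fps \<alpha> 1 - D\<close>,
    and the first term is \<open>B_even_fps x y * D\<close>.\<close>
  then have "fps_const (x + y) * even_fps (\<lambda>n. \<alpha> ^ n * 2 ^ (2 * n) / fact (2 * n))
      + even_fps (\<lambda>n. \<alpha> ^ (n + 1) / fact (2 * n)) - fps_const (1 + x * y) = (B_even_fps x y - 1) * D"
    using B_even_fps_mult[of x y]
    by (simp add: D_def \<alpha>_def left_diff_distrib cosh_fps_def)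
  moreover have "odd_fps (\<lambda>n. \<alpha> ^ n / fact (2 * n + 1)) = sinh_fps \<alpha> 1"
    by (simp add: sinh_fps_def)
  moreover have "(y ^ 2 - 1) * (x - 1) = \<alpha> * (1 + y)"
    by (simp add: \<alpha>_def power2_eq_square algebra_simps)
  moreover have "fps_const (\<alpha> * (1 + y)) * sinh_fps \<alpha> 1 = B_odd_fps x y * D"
    using B_odd_fps_mult[of x y] by (simp add: D_def \<alpha>_def)
  ultimately show ?thesis
    unfolding D_eq even using D by (simp add: B_odd_fps_def)
qed

end
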